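(* For every $\sigma\in\{\mathit{cf},\mathit{adm},\mathit{stb},\mathit{mod},\mathit{com},\mathit{prf},\mathit{grd}\}$ we have $\Delta_\sigma=\Sigma_{SFADF}^{\sigma}\setminus\Sigma_{SETADF}^{\sigma}$, where $$\Delta_\sigma=\{\mathbb V\in\Sigma_{SFADF}^{\sigma}\mid\exists v\in\mathbb V\text{ such that }(\forall a:\ v(a)\in\{\mathbf f,\mathbf u\})\ \wedge\ (\exists a:\ v(a)=\mathbf f)\}.$$
   Context: An ADF is $D=(S,L,C)$ with $S$ a finite set of arguments, $L\subseteq S\times S$ a set of links, and $C=\{\varphi_s\}_{s\in S}$ propositional formulas (acceptance conditions), where the atoms occurring in $\varphi_s$ are exactly $\mathrm{par}(s)=\{b\mid(b,s)\in L\}$. An interpretation is $v:S\to\{\mathbf t,\mathbf f,\mathbf u\}$; it is two-valued if it never takes the value $\mathbf u$; $v^{\mathbf t}=\{s\mid v(s)=\mathbf t\}$. The information order $\le_i$ on truth values is the reflexive closure of $\mathbf u<_i\mathbf t$, $\mathbf u<_i\mathbf f$, extended pointwise to interpretations. The partial valuation is $\varphi_s^v=v(\varphi_s)=\varphi_s[p/\top:v(p)=\mathbf t][p/\bot:v(p)=\mathbf f]$. The operator $\Gamma_D$ is: $\Gamma_D(v)(s)=\mathbf t$ if $\varphi_s^v$ is a tautology, $\mathbf f$ if $\varphi_s^v$ is unsatisfiable, $\mathbf u$ otherwise. An interpretation $v$ of $D$ is: - conflict-free ($\mathit{cf}$) iff $v(s)=\mathbf t$ implies $\varphi_s^v$ satisfiable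 and $v(s)=\mathbf f$ implies $\varphi_s^v$ unsatisfiable; - admissible ($\mathit{adm}$) iff $v\le_i\Gamma_D(v)$; complete ($\mathit{com}$) iff $v=\Gamma_D(v)$; grounded ($\mathit{grd}$) iff $v$ is the $\le_i$-least fixed point of $\Gamma_D$; preferred ($\mathit{prf}$) iff $v$ is $\le_i$-maximal admissible; - a model ($\mathit{mod}$) iff $v$ is two-valued and $v(s)=v(\varphi_s)$ for all $s\in S$; - a stable model ($\mathit{stb}$) iff $v$ is a model and $v^{\mathbf t}=w^{\mathbf t}$, where $w$ is the grounded interpretation of the reduct $D^v=(S^v,L^v,C^v)$ with $S^v=v^{\mathbf t}$, $L^v=L\cap(S^v\times S^v)$ and acceptance conditions $\varphi_s[p/\bot:v(p)=\mathbf f]$ for $s\in S^v$. $\sigma(D)$ is the set of all $\sigma$-interpretations of $D$. A link $(b,a)\in L$ is attacking if for every two-valued interpretation $v$ of $\mathrm{par}(a)$, $v(\varphi_a)=\mathbf f$ implies $v|^b_{\mathbf t}(\varphi_a)=\mathbf f$, where $v|^b_{\mathbf t}$ is $v$ with the value of $b$ changed to $\mathbf t$. An ADF is support-free (an SFADF) if it has only attacking links. An ADF is a SETADF if each of its acceptance conditions is of the form $\bigwedge_{cl\in\mathcal C}\bigvee_{a\in cl}\neg a$ with $\mathcal C$ a (possibly empty) set of non-empty sets of arguments (the condition is $\top$ if $\mathcal C=\emptyset$). For a class $\mathcal K$ of ADFs, the signature is $\Sigma_{\mathcal K}^\sigma=\{\sigma(D)\mid D\in\mathcal K\}$. *)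

theory Defs
  imports Main
begin

datatype (atoms: 'a) form =
    Top
  | Bot
  | Atom 'a
  | Neg "'a form"
  | Conj "'a form" "'a form"
  | Disj "'a form" "'a form"

primrec eval :: "('a \<Rightarrow> bool) \<Rightarrow> 'a form \<Rightarrow> bool" where
  "eval \<omega> Top = True"
| "eval \<omega> Bot = False"
| "eval \<omega> (Atom p) = \<omega> p"
| "eval \<omega> (Neg \<phi>) = (\<not> eval \<omega> \<phi>)"
| "eval \<omega> (Conj \<phi> \<psi>) = (eval \<omega> \<phi> \<and> eval \<omega> \<psi>)"
| "eval \<omega> (Disj \<phi> \<psi>) = (eval \<omega> \<phi> \<or> eval \<omega> \<psi>)"

definition tautology :: "'a form \<Rightarrow> bool" where
  "tautology \<phi> \<longleftrightarrow> (\<forall>\<omega>. eval \<omega> \<phi>)"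

definition satisfiable :: "'a form \<Rightarrow> bool" where
  "satisfiable \<phi> \<longleftrightarrow> (\<exists>\<omega>. eval \<omega> \<phi>)"

primrec subst :: "('a \<Rightarrow> 'a form) \<Rightarrow> 'a form \<Rightarrow> 'a form" where
  "subst \<theta> Top = Top"
| "subst \<theta> Bot = Bot"
| "subst \<theta> (Atom p) = \<theta> p"
| "subst \<theta> (Neg \<phi>) = Neg (subst \<theta> \<phi>)"
| "subst \<theta> (Conj \<phi> \<psi>) = Conj (subst \<theta> \<phi>) (subst \<theta> \<psi>)"
| "subst \<theta> (Disj \<phi> \<psi>) = Disj (subst \<theta> \<phi>) (subst \<theta> \<psi>)"

fun big_conj :: "'a form list \<Rightarrow> 'a form" where
  "big_conj [] = Top"
| "big_conj [\<phi>] = \<phi>"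
| "big_conj (\<phi> # \<psi> # \<phi>s) = Conj \<phi> (big_conj (\<psi> # \<phi>s))"

fun big_disj :: "'a form list \<Rightarrow> 'a form" where
  "big_disj [] = Bot"
| "big_disj [\<phi>] = \<phi>"
| "big_disj (\<phi> # \<psi> # \<phi>s) = Disj \<phi> (big_disj (\<psi> # \<phi>s))"


text \<open>The acceptance conditions form a family indexed by the arguments; the values of
  \<open>ac D\<close> outside \<open>args D\<close> are irrelevant.\<close>

record 'a adf =
  args :: "'a set"
  links :: "('a \<times> 'a) set"
  ac :: "'a \<Rightarrow> 'a form"

definition par :: "'a adf \<Rightarrow> 'a \<Rightarrow> 'a set" where
  "par D s = {b. (b, s) \<in> links D}"

definition is_adf :: "'a adf \<Rightarrow> bool" where
  "is_adf D \<longleftrightarrow> finite (args D) \<and> links D \<subseteq> args D \<times> args D \<and>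
     (\<forall>s \<in> args D. atoms (ac D s) = par D s)"


datatype tv = TT | FF | UU

text \<open>An interpretation of a set \<open>S\<close> of arguments is a map with domain exactly \<open>S\<close>,
  so that interpretations of different sets of arguments are never identified.\<close>

type_synonym 'a interp = "'a \<rightharpoonup> tv"

definition interps :: "'a set \<Rightarrow> 'a interp set" where
  "interps S = {v. dom v = S}"

definition two_valued :: "'a interp \<Rightarrow> bool" where
  "two_valued v \<longleftrightarrow> (\<forall>s \<in> dom v. v s \<noteq> Some UU)"

definition trues :: "'a interp \<Rightarrow> 'a set" where
  "trues v = {s. v s = Some TT}"

definition tv_le :: "tv \<Rightarrow> tv \<Rightarrow> bool" where
  "tv_le x y \<longleftrightarrow> x = y \<or> (x = UU \<and> y \<in> {TT, FF})"

definition info_le :: "'a interp \<Rightarrow> 'a interp \<Rightarrow> bool" (infix "\<le>\<^sub>i" 50) where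
  "v \<le>\<^sub>i w \<longleftrightarrow> dom v = dom w \<and> (\<forall>s \<in> dom v. tv_le (the (v s)) (the (w s)))"

definition pval :: "'a interp \<Rightarrow> 'a form \<Rightarrow> 'a form" where
  "pval v = subst (\<lambda>p. if v p = Some TT then Top else if v p = Some FF then Bot else Atom p)"

text \<open>The truth value of a formula all of whose atoms lie in the domain of the two-valued
  interpretation \<open>v\<close>.\<close>

definition tval :: "'a interp \<Rightarrow> 'a form \<Rightarrow> tv" where
  "tval v \<phi> = (if eval (\<lambda>p. v p = Some TT) \<phi> then TT else FF)"

definition Gamma :: "'a adf \<Rightarrow> 'a interp \<Rightarrow> 'a interp" where
  "Gamma D v = (\<lambda>s. if s \<in> args D
      then Some (if tautology (pval v (ac D s)) then TT
                 else if \<not> satisfiable (pval v (ac D s)) then FF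
                 else UU)
      else None)"


definition conflict_free :: "'a adf \<Rightarrow> 'a interp set" where
  "conflict_free D = {v \<in> interps (args D). \<forall>s \<in> args D.
     (v s = Some TT \<longrightarrow> satisfiable (pval v (ac D s))) \<and>
     (v s = Some FF \<longrightarrow> \<not> satisfiable (pval v (ac D s)))}"

definition admissible :: "'a adf \<Rightarrow> 'a interp set" where
  "admissible D = {v \<in> interps (args D). v \<le>\<^sub>i Gamma D v}"

definition complete :: "'a adf \<Rightarrow> 'a interp set" where
  "complete D = {v \<in> interps (args D). v = Gamma D v}"

definition grounded :: "'a adf \<Rightarrow> 'a interp set" where
  "grounded D = {v \<in> interps (args D). v = Gamma D v \<and>
     (\<forall>w \<in> interps (args D). w = Gamma D w \<longrightarrow> v \<le>\<^sub>i w)}"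

definition preferred :: "'a adf \<Rightarrow> 'a interp set" where
  "preferred D = {v \<in> admissible D. \<forall>w \<in> admissible D. v \<le>\<^sub>i w \<longrightarrow> w = v}"

definition models :: "'a adf \<Rightarrow> 'a interp set" where
  "models D = {v \<in> interps (args D). two_valued v \<and>
     (\<forall>s \<in> args D. v s = Some (tval v (ac D s)))}"

definition reduct :: "'a adf \<Rightarrow> 'a interp \<Rightarrow> 'a adf" where
  "reduct D v = \<lparr>
     args = trues v,
     links = links D \<inter> (trues v \<times> trues v),
     ac = (\<lambda>s. subst (\<lambda>p. if v p = Some FF then Bot else Atom p) (ac D s))\<rparr>"

definition stable_models :: "'a adf \<Rightarrow> 'a interp set" where
  "stable_models D = {v \<in> models D. \<exists>w \<in> grounded (reduct D v). trues v = trues w}"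

datatype semantics = CF | ADM | STB | MOD | COM | PRF | GRD

primrec sem :: "semantics \<Rightarrow> 'a adf \<Rightarrow> 'a interp set" where
  "sem CF = conflict_free"
| "sem ADM = admissible"
| "sem STB = stable_models"
| "sem MOD = models"
| "sem COM = complete"
| "sem PRF = preferred"
| "sem GRD = grounded"


definition attacking :: "'a adf \<Rightarrow> 'a \<Rightarrow> 'a \<Rightarrow> bool" where
  "attacking D b a \<longleftrightarrow> (\<forall>v \<in> interps (par D a). two_valued v \<longrightarrow>
     tval v (ac D a) = FF \<longrightarrow> tval (v(b \<mapsto> TT)) (ac D a) = FF)"

definition SFADF :: "'a adf set" where
  "SFADF = {D. is_adf D \<and> (\<forall>(b, a) \<in> links D. attacking D b a)}"

text \<open>Lists fix an order and bracketing in which the finite sets of clauses and of literals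
  are written out as a formula.\<close>

definition setadf_form :: "'a form \<Rightarrow> bool" where
  "setadf_form \<phi> \<longleftrightarrow> (\<exists>cls. (\<forall>cl \<in> set cls. cl \<noteq> []) \<and>
     \<phi> = big_conj (map (\<lambda>cl. big_disj (map (\<lambda>a. Neg (Atom a)) cl)) cls))"

definition SETADF :: "'a adf set" where
  "SETADF = {D. is_adf D \<and> (\<forall>s \<in> args D. setadf_form (ac D s))}"

definition signature :: "'a adf set \<Rightarrow> semantics \<Rightarrow> 'a interp set set" where
  "signature K \<sigma> = {sem \<sigma> D | D. D \<in> K}"

definition Delta :: "semantics \<Rightarrow> 'a interp set set" where
  "Delta \<sigma> = {V \<in> signature SFADF \<sigma>. \<exists>v \<in> V.
     (\<forall>a \<in> dom v. v a \<in> {Some FF, Some UU}) \<and> (\<exists>a \<in> dom v. v a = Some FF)}"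

end

theory Submission
  imports Defs
begin

text \<open>A SETADF condition holds when all arguments are false, so in a SETADF no argument can be
  rejected unless some argument is accepted; this makes the interpretations singled out in
  \<open>\<Delta>\<close> unrealizable. Conversely, every acceptance condition of an SFADF is antitone, hence it is either
  unsatisfiable or equivalent to a conjunction of non-empty negative clauses. As long as every
  rejection comes with an accepted argument, an unsatisfiable condition may be traded for
  \<open>\<And>a\<in>S. \<not>a\<close>, which also keeps the argument itself from being accepted. This preserves
  all semantics except the complete and grounded ones; for these, the conditions of the arguments
  decided by the grounded interpretation are replaced by \<open>\<top>\<close> and \<open>\<And>a\<in>S. \<not>a\<close>.\<close>

section \<open>Formulas\<close>

lemma eval_subst: "eval \<omega> (subst \<theta> \<phi>) \<longleftrightarrow> eval (\<lambda>p. eval \<omega> (\<theta> p)) \<phi>"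
  by (induction \<phi>) auto

lemma eval_cong: "(\<And>p. p \<in> atoms \<phi> \<Longrightarrow> \<omega> p = \<omega>' p) \<Longrightarrow> eval \<omega> \<phi> = eval \<omega>' \<phi>"
  by (induction \<phi>) auto

lemma finite_atoms: "finite (atoms \<phi>)"
  by (induction \<phi>) auto

lemma eval_big_conj: "eval \<omega> (big_conj \<phi>s) \<longleftrightarrow> (\<forall>\<phi> \<in> set \<phi>s. eval \<omega> \<phi>)"
  by (induction \<phi>s rule: big_conj.induct) auto

lemma eval_big_disj: "eval \<omega> (big_disj \<phi>s) \<longleftrightarrow> (\<exists>\<phi> \<in> set \<phi>s. eval \<omega> \<phi>)"
  by (induction \<phi>s rule: big_disj.induct) auto

lemma atoms_big_conj: "atoms (big_conj \<phi>s) = (\<Union>\<phi> \<in> set \<phi>s. atoms \<phi>)"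
  by (induction \<phi>s rule: big_conj.induct) auto

lemma atoms_big_disj: "atoms (big_disj \<phi>s) = (\<Union>\<phi> \<in> set \<phi>s. atoms \<phi>)"
  by (induction \<phi>s rule: big_disj.induct) auto

text \<open>Clauses are non-empty, so each contains a negated atom, which is true when every atom is
  false.\<close>

lemma setadf_form_eval_False:
  assumes "setadf_form \<phi>" and "\<And>p. \<not> \<omega> p"
  shows "eval \<omega> \<phi>"
  using assms by (fastforce simp: setadf_form_def eval_big_conj eval_big_disj neq_Nil_conv)

text \<open>Bridges the gap between clauses as sets, in which the normal form is found, and clauses
  as lists, as in \<open>setadf_form\<close>.\<close>

lemma ex_list_of_sets:
  assumes "finite F" and "\<And>A. A \<in> F \<Longrightarrow> finite A"
  shows "\<exists>xss. set ` set xss = F"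
  using assms
proof (induction F rule: finite_induct)
  case (insert A F)
  then obtain xss where "set ` set xss = F" by auto
  moreover obtain xs where "set xs = A" using insert.prems finite_list by blast
  ultimately have "set ` set (xs # xss) = insert A F" by simp
  then show ?case by blast
qed simp

lemma ex_setadf_form:
  assumes "finite F" and "\<And>A. A \<in> F \<Longrightarrow> finite A \<and> A \<noteq> {}"
  shows "\<exists>\<psi>. setadf_form \<psi> \<and> atoms \<psi> = \<Union>F \<and>
    (\<forall>\<omega>. eval \<omega> \<psi> \<longleftrightarrow> (\<forall>A \<in> F. \<exists>a \<in> A. \<not> \<omega> a))"
proof -
  obtain cls where cls: "F = set ` set cls" using ex_list_of_sets assms by metis
  let ?\<psi> = "big_conj (map (\<lambda>cl. big_disj (map (\<lambda>a. Neg (Atom a)) cl)) cls)"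
  have "setadf_form ?\<psi>"
    unfolding setadf_form_def using assms(2) cls by (intro exI[of _ cls]) auto
  moreover have "atoms ?\<psi> = \<Union>F"
    by (auto simp: atoms_big_conj atoms_big_disj cls)
  ultimately show ?thesis
    by (intro exI[of _ ?\<psi>]) (simp add: eval_big_conj eval_big_disj cls)
qed

text \<open>Singleton clauses do it. For \<open>S\<close> the set of all arguments this gives the
  substitute for a condition that must fail; for empty \<open>S\<close> it gives truth.\<close>

lemma ex_setadf_form_none:
  assumes "finite S"
  shows "\<exists>\<psi>. setadf_form \<psi> \<and> atoms \<psi> \<subseteq> S \<and> (\<forall>\<omega>. eval \<omega> \<psi> \<longleftrightarrow> (\<forall>a \<in> S. \<not> \<omega> a))"
proof -
  let ?F = "(\<lambda>a. {a}) ` S"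
  have "\<Union>?F = S" by auto
  moreover have "finite ?F" "\<And>A. A \<in> ?F \<Longrightarrow> finite A \<and> A \<noteq> {}" using assms by auto
  ultimately obtain \<psi> where "setadf_form \<psi>" "atoms \<psi> = S"
      "\<forall>\<omega>. eval \<omega> \<psi> \<longleftrightarrow> (\<forall>A \<in> ?F. \<exists>a \<in> A. \<not> \<omega> a)"
    using ex_setadf_form[of ?F] by metis
  then show ?thesis by (intro exI[of _ \<psi>]) simp
qed

section \<open>Antitone formulas and their negative clausal form\<close>

definition antitone_form :: "'a form \<Rightarrow> bool" where
  "antitone_form \<phi> \<longleftrightarrow> (\<forall>\<omega> \<omega>'. (\<forall>p. \<omega> p \<longrightarrow> \<omega>' p) \<longrightarrow> eval \<omega>' \<phi> \<longrightarrow> eval \<omega> \<phi>)"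

lemma antitone_formD:
  assumes "antitone_form \<phi>" and "eval \<omega>' \<phi>" and "\<And>p. \<omega> p \<Longrightarrow> \<omega>' p"
  shows "eval \<omega> \<phi>"
  using assms(1)[unfolded antitone_form_def, rule_format, of \<omega> \<omega>'] assms(2,3) by simp

text \<open>Only finitely many atoms matter, so the larger valuation can be lowered to the smaller
  one by switching off one atom at a time.\<close>

lemma antitone_formI:
  assumes flip: "\<And>\<omega> b. b \<in> atoms \<phi> \<Longrightarrow> eval (\<omega>(b := True)) \<phi> \<Longrightarrow> eval \<omega> \<phi>"
  shows "antitone_form \<phi>"
  unfolding antitone_form_def
proof (intro allI impI)
  fix \<omega> \<omega>' :: "'a \<Rightarrow> bool"
  assume le: "\<forall>p. \<omega> p \<longrightarrow> \<omega>' p" and ev: "eval \<omega>' \<phi>"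
  \<comment> \<open>\<open>B\<close> collects the atoms forced to be true on top of the smaller
    valuation; the induction removes them one by one with \<open>flip\<close>.\<close>
  have many: "eval \<omega> \<phi>" if "finite B" "B \<subseteq> atoms \<phi>" "eval (\<lambda>p. p \<in> B \<or> \<omega> p) \<phi>" for B
    using that
  proof (induction B rule: finite_induct)
    case (insert b B)
    have "(\<lambda>p. p \<in> B \<or> \<omega> p)(b := True) = (\<lambda>p. p \<in> insert b B \<or> \<omega> p)" by auto
    then have "eval (\<lambda>p. p \<in> B \<or> \<omega> p) \<phi>" using insert.prems flip[of b] by auto
    then show ?case using insert by blast
  qed simp
  let ?B = "{p \<in> atoms \<phi>. \<omega>' p}"
  have "eval (\<lambda>p. p \<in> ?B \<or> \<omega> p) \<phi> = eval \<omega>' \<phi>"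
    using le by (intro eval_cong) auto
  then show "eval \<omega> \<phi>" using many[of ?B] ev finite_atoms[of \<phi>] by auto
qed

text \<open>Each set \<open>A\<close> of atoms that falsifies the formula when exactly
  \<open>A\<close> is true yields the clause "some member of \<open>A\<close> is false". By
  antitonicity a valuation making all of \<open>A\<close> true falsifies the formula, so these
  clauses characterize it. Satisfiability makes the all-false valuation a model, which keeps the
  empty clause out.\<close>

lemma antitone_form_normal_form:
  assumes anti: "antitone_form \<phi>" and sat: "satisfiable \<phi>"
  shows "\<exists>\<psi>. setadf_form \<psi> \<and> atoms \<psi> \<subseteq> atoms \<phi> \<and> (\<forall>\<omega>. eval \<omega> \<psi> = eval \<omega> \<phi>)"
proof -
  define F where "F = {A \<in> Pow (atoms \<phi>). \<not> eval (\<lambda>p. p \<in> A) \<phi>}"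
  obtain \<omega>' where "eval \<omega>' \<phi>" using sat unfolding satisfiable_def ..
  then have "eval (\<lambda>p. p \<in> {}) \<phi>" by (rule antitone_formD[OF anti]) simp
  then have nonempty: "{} \<notin> F" by (simp add: F_def)
  have sub: "A \<subseteq> atoms \<phi>" if "A \<in> F" for A using that by (simp add: F_def)
  then have "finite A \<and> A \<noteq> {}" if "A \<in> F" for A
    using that nonempty finite_subset[OF _ finite_atoms] by metis
  moreover have "finite F" using finite_atoms[of \<phi>] by (simp add: F_def)
  ultimately obtain \<psi> where \<psi>: "setadf_form \<psi>" "atoms \<psi> = \<Union>F"
      "\<And>\<omega>. eval \<omega> \<psi> \<longleftrightarrow> (\<forall>A \<in> F. \<exists>a \<in> A. \<not> \<omega> a)"
    using ex_setadf_form[of F] by metis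
  have "eval \<omega> \<psi> = eval \<omega> \<phi>" for \<omega>
  proof
    \<comment> \<open>The true atoms themselves: were this set in \<open>F\<close>, its clause would
      be violated.\<close>
    define A where "A = {p \<in> atoms \<phi>. \<omega> p}"
    assume "eval \<omega> \<psi>"
    moreover have "\<not> (\<exists>a \<in> A. \<not> \<omega> a)" by (simp add: A_def)
    ultimately have "A \<notin> F" using \<psi>(3) by blast
    moreover have "A \<subseteq> atoms \<phi>" by (auto simp: A_def)
    ultimately have "eval (\<lambda>p. p \<in> A) \<phi>" by (simp add: F_def)
    also have "eval (\<lambda>p. p \<in> A) \<phi> = eval \<omega> \<phi>" by (intro eval_cong) (simp add: A_def)
    finally show "eval \<omega> \<phi>" .
  next
    assume ev: "eval \<omega> \<phi>"
    have "\<exists>a \<in> A. \<not> \<omega> a" if "A \<in> F" for A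
    proof (rule ccontr)
      assume "\<not> (\<exists>a \<in> A. \<not> \<omega> a)"
      then have "eval (\<lambda>p. p \<in> A) \<phi>" by (intro antitone_formD[OF anti ev]) simp
      then show False using that by (simp add: F_def)
    qed
    then show "eval \<omega> \<psi>" using \<psi>(3) by simp
  qed
  \<comment> \<open>Only an inclusion can be claimed: for a tautology \<open>F\<close> is empty and
    all atoms disappear.\<close>
  moreover have "atoms \<psi> \<subseteq> atoms \<phi>" using \<psi>(2) sub by blast
  ultimately show ?thesis using \<psi>(1) by blast
qed

lemma antitone_form_ac:
  assumes "D \<in> SFADF" and "s \<in> args D"
  shows "antitone_form (ac D s)"
proof (rule antitone_formI)
  fix \<omega> b
  assume b: "b \<in> atoms (ac D s)" and ev: "eval (\<omega>(b := True)) (ac D s)"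
  have at: "atoms (ac D s) = par D s" using assms by (auto simp: SFADF_def is_adf_def)
  have att: "attacking D b s" using assms(1) b at by (auto simp: SFADF_def par_def)
  \<comment> \<open>The valuation restricted to the parents, the form of interpretation that
    \<open>attacking\<close> speaks about; the condition sees no other atoms. The contrapositive of
    \<open>attacking\<close> is then the required flip.\<close>
  define v where "v = (\<lambda>p. if p \<in> par D s then Some (if \<omega> p then TT else FF) else None)"
  have "v \<in> interps (par D s)" "two_valued v"
    by (auto simp: v_def interps_def two_valued_def split: if_splits)
  then have "tval v (ac D s) = FF \<longrightarrow> tval (v(b \<mapsto> TT)) (ac D s) = FF"
    using att unfolding attacking_def by blast
  moreover have "eval (\<lambda>p. v p = Some TT) (ac D s) = eval \<omega> (ac D s)"
    by (intro eval_cong) (simp add: at v_def)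
  moreover have "eval (\<lambda>p. (v(b \<mapsto> TT)) p = Some TT) (ac D s) = eval (\<omega>(b := True)) (ac D s)"
    by (intro eval_cong) (simp add: at v_def)
  ultimately show "eval \<omega> (ac D s)"
    using ev unfolding tval_def by (simp split: if_splits)
qed

section \<open>Interpretations and the operator\<close>

text \<open>Total valuations that respect the decided values and are free elsewhere, also outside
  the domain. Quantifying over them replaces reasoning about the substitution in
  \<open>pval\<close>.\<close>

definition completion :: "'a interp \<Rightarrow> ('a \<Rightarrow> bool) \<Rightarrow> bool" where
  "completion v \<omega> \<longleftrightarrow> (\<forall>p. (v p = Some TT \<longrightarrow> \<omega> p) \<and> (v p = Some FF \<longrightarrow> \<not> \<omega> p))"

lemma eval_pval:
  "eval \<omega> (pval v \<phi>) \<longleftrightarrow>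
    eval (\<lambda>p. if v p = Some TT then True else if v p = Some FF then False else \<omega> p) \<phi>"
  unfolding pval_def eval_subst by (rule eval_cong) simp

lemma completion_pval: "completion v \<omega> \<Longrightarrow> eval \<omega> (pval v \<phi>) = eval \<omega> \<phi>"
  unfolding eval_pval by (rule eval_cong) (simp add: completion_def)

lemma completion_override:
  "completion v (\<lambda>p. if v p = Some TT then True else if v p = Some FF then False else \<omega> p)"
  by (simp add: completion_def)

lemma tautology_pval: "tautology (pval v \<phi>) \<longleftrightarrow> (\<forall>\<omega>. completion v \<omega> \<longrightarrow> eval \<omega> \<phi>)"
  unfolding tautology_def
  using completion_pval[of v _ \<phi>] completion_override[of v] eval_pval[of _ v \<phi>] by blast

lemma satisfiable_pval: "satisfiable (pval v \<phi>) \<longleftrightarrow> (\<exists>\<omega>. completion v \<omega> \<and> eval \<omega> \<phi>)"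
  unfolding satisfiable_def
  using completion_pval[of v _ \<phi>] completion_override[of v] eval_pval[of _ v \<phi>] by blast

lemma completion_exists: "\<exists>\<omega>. completion v \<omega>"
  using completion_override by blast

lemma Gamma_interps: "Gamma D v \<in> interps (args D)"
  by (auto simp: Gamma_def interps_def split: if_splits)

lemma interps_mem: "v \<in> interps S \<Longrightarrow> v s = Some x \<Longrightarrow> s \<in> S"
  by (auto simp: interps_def)

lemma Gamma_cong:
  assumes "args D = args E" and "\<And>\<omega>. s \<in> args E \<Longrightarrow> eval \<omega> (ac D s) = eval \<omega> (ac E s)"
  shows "Gamma D v s = Gamma E v s"
proof (cases "s \<in> args E")
  case True
  then have "tautology (pval v (ac D s)) = tautology (pval v (ac E s))"
    "satisfiable (pval v (ac D s)) = satisfiable (pval v (ac E s))"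
    using assms(2) by (simp_all add: tautology_pval satisfiable_pval)
  then show ?thesis by (simp add: Gamma_def assms(1))
next
  case False
  then show ?thesis by (simp add: Gamma_def assms(1))
qed

lemma Gamma_TT_iff:
  "s \<in> args D \<Longrightarrow> Gamma D v s = Some TT \<longleftrightarrow> (\<forall>\<omega>. completion v \<omega> \<longrightarrow> eval \<omega> (ac D s))"
  by (simp add: Gamma_def tautology_pval)

lemma Gamma_FF_iff:
  "s \<in> args D \<Longrightarrow> Gamma D v s = Some FF \<longleftrightarrow> (\<forall>\<omega>. completion v \<omega> \<longrightarrow> \<not> eval \<omega> (ac D s))"
  using completion_exists[of v] by (auto simp: Gamma_def tautology_pval satisfiable_pval)

lemma interps_Some: "v \<in> interps S \<Longrightarrow> s \<in> S \<Longrightarrow> \<exists>x. v s = Some x"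
  by (auto simp: interps_def)

lemma interps_None: "v \<in> interps S \<Longrightarrow> s \<notin> S \<Longrightarrow> v s = None"
  by (auto simp: interps_def)

section \<open>The information order, maximal elements and the grounded interpretation\<close>

lemma info_le_iff:
  assumes "v \<in> interps S" and "w \<in> interps S"
  shows "v \<le>\<^sub>i w \<longleftrightarrow> (\<forall>s \<in> S. (v s = Some TT \<longrightarrow> w s = Some TT) \<and> (v s = Some FF \<longrightarrow> w s = Some FF))"
proof -
  have "tv_le (the (v s)) (the (w s)) \<longleftrightarrow>
      (v s = Some TT \<longrightarrow> w s = Some TT) \<and> (v s = Some FF \<longrightarrow> w s = Some FF)" if s: "s \<in> S" for s
  proof -
    obtain x where "v s = Some x" using interps_Some[OF assms(1) s] by blast
    moreover obtain y where "w s = Some y" using interps_Some[OF assms(2) s] by blast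
    ultimately show ?thesis by (cases x; cases y) (simp_all add: tv_le_def)
  qed
  moreover have "dom v = S" "dom w = S" using assms by (simp_all add: interps_def)
  ultimately show ?thesis by (simp add: info_le_def)
qed

lemma info_le_refl: "v \<le>\<^sub>i v"
  by (simp add: info_le_def tv_le_def)

lemma info_le_trans: "u \<le>\<^sub>i v \<Longrightarrow> v \<le>\<^sub>i w \<Longrightarrow> u \<le>\<^sub>i w"
  unfolding info_le_def tv_le_def by metis

lemma info_le_apply: "v \<le>\<^sub>i w \<Longrightarrow> v s = Some x \<Longrightarrow> x \<noteq> UU \<Longrightarrow> w s = Some x"
  unfolding info_le_def tv_le_def using domI[of v s x] by (auto simp: dom_def)

lemma completion_antimono: "v \<le>\<^sub>i w \<Longrightarrow> completion w \<omega> \<Longrightarrow> completion v \<omega>"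
  unfolding completion_def using info_le_apply[of v w] by simp

text \<open>Both decided values are universal over completions, and more information leaves fewer
  completions.\<close>

lemma Gamma_mono: "v \<le>\<^sub>i w \<Longrightarrow> Gamma D v \<le>\<^sub>i Gamma D w"
  by (auto simp: info_le_iff[OF Gamma_interps Gamma_interps] Gamma_TT_iff Gamma_FF_iff
      dest: completion_antimono)

text \<open>Among the members of \<open>X\<close> above \<open>v\<close>, take one with the most
  decided arguments. Anything above it decides at least the same arguments with the same values, and
  by cardinality no others.\<close>

lemma ex_info_maximal:
  assumes fin: "finite S" and X: "X \<subseteq> interps S" and v: "v \<in> X"
  shows "\<exists>w \<in> X. v \<le>\<^sub>i w \<and> (\<forall>u \<in> X. w \<le>\<^sub>i u \<longrightarrow> u = w)"
proof -
  let ?d = "\<lambda>w :: 'a interp. {s \<in> S. w s \<noteq> Some UU}"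
  let ?P = "\<lambda>w. w \<in> X \<and> v \<le>\<^sub>i w"
  have "\<forall>w. ?P w \<longrightarrow> card (?d w) < Suc (card S)"
    using fin by (auto intro: card_mono simp: less_Suc_eq_le)
  then obtain w where w: "?P w" and max: "\<And>u. ?P u \<Longrightarrow> card (?d u) \<le> card (?d w)"
    using ex_has_greatest_nat[of ?P v "\<lambda>w. card (?d w)"] v info_le_refl by blast
  have "u = w" if u: "u \<in> X" "w \<le>\<^sub>i u" for u
  proof -
    have iu: "u \<in> interps S" and iw: "w \<in> interps S" using X u w by auto
    have sub: "?d w \<subseteq> ?d u"
    proof
      fix s assume s: "s \<in> ?d w"
      then obtain x where x: "w s = Some x" "x \<noteq> UU" using interps_Some[OF iw] by auto
      then show "s \<in> ?d u" using s info_le_apply[OF u(2)] by auto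
    qed
    have "card (?d u) \<le> card (?d w)" using max u w info_le_trans by blast
    then have eq: "?d w = ?d u" using sub fin by (intro card_seteq) auto
    show ?thesis
    proof
      fix s
      consider "s \<notin> S" | "s \<in> S" "w s = Some UU" | x where "w s = Some x" "x \<noteq> UU"
        using interps_Some[OF iw] by metis
      then show "u s = w s"
      proof cases
        case 1
        then show ?thesis using interps_None[OF iu] interps_None[OF iw] by simp
      next
        case 2
        then show ?thesis using eq by auto
      next
        case 3
        then show ?thesis using info_le_apply[OF u(2)] by simp
      qed
    qed
  qed
  then show ?thesis using w by blast
qed

lemma ex_preferred_above:
  assumes "finite (args D)" and "v \<in> admissible D"
  shows "\<exists>w \<in> preferred D. v \<le>\<^sub>i w"
  using ex_info_maximal[of "args D" "admissible D" v] assms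
  by (auto simp: admissible_def preferred_def)

text \<open>A maximal admissible lower bound of the complete interpretations is a fixed point.\<close>

lemma grounded_exists:
  assumes "finite (args D)"
  shows "\<exists>g. g \<in> grounded D"
proof -
  let ?X = "{v \<in> admissible D. \<forall>w \<in> complete D. v \<le>\<^sub>i w}"
  let ?bot = "\<lambda>s. if s \<in> args D then Some UU else None"
  have bot: "?bot \<in> interps (args D)" by (auto simp: interps_def split: if_splits)
  then have "?bot \<in> ?X"
    by (auto simp: admissible_def complete_def info_le_iff Gamma_interps)
  then obtain g where g: "g \<in> ?X" and max: "\<And>u. u \<in> ?X \<Longrightarrow> g \<le>\<^sub>i u \<Longrightarrow> u = g"
    using ex_info_maximal[of "args D" ?X ?bot] assms by (auto simp: admissible_def)
  have le: "g \<le>\<^sub>i Gamma D g" using g by (simp add: admissible_def)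
  \<comment> \<open>Monotonicity carries both defining properties of \<open>?X\<close> from
    \<open>g\<close> to its image, as each \<open>w\<close> is its own image; maximality then forces
    a fixed point.\<close>
  have "Gamma D g \<le>\<^sub>i w" if "w \<in> complete D" for w
    using Gamma_mono[of g w D] g that by (auto simp: complete_def)
  then have "Gamma D g \<in> ?X"
    using Gamma_mono[OF le] by (simp add: admissible_def Gamma_interps)
  then have "Gamma D g = g" using max le by blast
  then have "g \<in> grounded D"
    using g by (auto simp: grounded_def admissible_def complete_def)
  then show ?thesis by blast
qed

text \<open>Makes the grounded semantics a function of the complete one, so that equal complete
  semantics settle both cases.\<close>

lemma grounded_eq:
  "grounded D = {v \<in> complete D. \<forall>w \<in> complete D. v \<le>\<^sub>i w}"
  by (auto simp: grounded_def complete_def)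

lemma complete_sub_admissible: "complete D \<subseteq> admissible D"
  using info_le_refl by (fastforce simp: complete_def admissible_def)

section \<open>The semantics expressed by completions\<close>

lemma conflict_free_iff:
  "v \<in> conflict_free F \<longleftrightarrow> v \<in> interps (args F) \<and> (\<forall>s \<in> args F.
    (v s = Some TT \<longrightarrow> (\<exists>\<omega>. completion v \<omega> \<and> eval \<omega> (ac F s))) \<and>
    (v s = Some FF \<longrightarrow> (\<forall>\<omega>. completion v \<omega> \<longrightarrow> \<not> eval \<omega> (ac F s))))"
  by (auto simp: conflict_free_def satisfiable_pval)

lemma admissible_iff:
  "v \<in> admissible F \<longleftrightarrow> v \<in> interps (args F) \<and> (\<forall>s \<in> args F.
    (v s = Some TT \<longrightarrow> (\<forall>\<omega>. completion v \<omega> \<longrightarrow> eval \<omega> (ac F s))) \<and>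
    (v s = Some FF \<longrightarrow> (\<forall>\<omega>. completion v \<omega> \<longrightarrow> \<not> eval \<omega> (ac F s))))"
proof -
  have "v \<le>\<^sub>i Gamma F v \<longleftrightarrow> (\<forall>s \<in> args F.
    (v s = Some TT \<longrightarrow> (\<forall>\<omega>. completion v \<omega> \<longrightarrow> eval \<omega> (ac F s))) \<and>
    (v s = Some FF \<longrightarrow> (\<forall>\<omega>. completion v \<omega> \<longrightarrow> \<not> eval \<omega> (ac F s))))"
    if "v \<in> interps (args F)"
    unfolding info_le_iff[OF that Gamma_interps] by (simp add: Gamma_TT_iff Gamma_FF_iff)
  then show ?thesis unfolding admissible_def by auto
qed

lemma models_iff:
  "v \<in> models F \<longleftrightarrow> v \<in> interps (args F) \<and> two_valued v \<and>
    (\<forall>s \<in> args F. v s = Some TT \<longleftrightarrow> eval (\<lambda>p. v p = Some TT) (ac F s))"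
proof -
  have "v s = Some (tval v (ac F s)) \<longleftrightarrow> (v s = Some TT \<longleftrightarrow> eval (\<lambda>p. v p = Some TT) (ac F s))"
    if v: "v \<in> interps (args F)" "two_valued v" and s: "s \<in> args F" for s
  proof -
    obtain x where x: "v s = Some x" using interps_Some[OF v(1) s] by blast
    then have "x \<noteq> UU" using v(2) domI[of v s x] by (auto simp: two_valued_def)
    then show ?thesis using x by (cases x) (simp_all add: tval_def)
  qed
  then show ?thesis unfolding models_def by (simp cong: conj_cong)
qed

lemma args_reduct: "args (reduct F v) = trues v"
  by (simp add: reduct_def)

section \<open>Rejections without an accepted argument\<close>

text \<open>The complement of the pattern in \<open>Delta\<close>. The accepted argument need not be
  related to the rejected one by a link.\<close>

definition rejections_explained :: "'a interp \<Rightarrow> bool" where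
  "rejections_explained v \<longleftrightarrow> (\<forall>s. v s = Some FF \<longrightarrow> (\<exists>a. v a = Some TT))"

lemma rejections_explained_iff:
  "rejections_explained v \<longleftrightarrow>
    \<not> ((\<forall>a \<in> dom v. v a \<in> {Some FF, Some UU}) \<and> (\<exists>a \<in> dom v. v a = Some FF))"
proof -
  have "(\<forall>a \<in> dom v. v a \<in> {Some FF, Some UU}) \<longleftrightarrow> (\<forall>a. v a \<noteq> Some TT)"
    by (auto simp: dom_def) (metis tv.exhaust)
  moreover have "(\<exists>a \<in> dom v. v a = Some FF) \<longleftrightarrow> (\<exists>a. v a = Some FF)" by auto
  ultimately show ?thesis unfolding rejections_explained_def by auto
qed

lemma Delta_eq:
  "Delta \<sigma> = {V \<in> signature SFADF \<sigma>. \<exists>v \<in> V. \<not> rejections_explained v}"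
  unfolding Delta_def rejections_explained_iff by simp

text \<open>Every semantics lies within the conflict-free, the admissible or the two-valued models.
  In the first two, rejection falsifies the condition under all completions, among them the one
  making exactly the accepted arguments true; for models this is the defining valuation.\<close>

lemma sem_rejected_condition:
  assumes v: "v \<in> sem \<sigma> D" and s: "v s = Some FF"
  shows "s \<in> args D \<and> \<not> eval (\<lambda>p. v p = Some TT) (ac D s)"
proof -
  have com: "completion v (\<lambda>p. v p = Some TT)" by (simp add: completion_def)
  have cf: ?thesis if "v \<in> conflict_free D"
  proof -
    have "s \<in> args D" using that by (intro interps_mem[of v _ s, OF _ s]) (simp add: conflict_free_def)
    moreover from this have "\<not> satisfiable (pval v (ac D s))"
      using that s by (simp add: conflict_free_def)
    ultimately show ?thesis using com by (auto simp: satisfiable_pval)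
  qed
  have adm: ?thesis if "v \<in> admissible D"
  proof -
    have "s \<in> args D" using that by (intro interps_mem[of v _ s, OF _ s]) (simp add: admissible_def)
    moreover have "Gamma D v s = Some FF"
      using that s info_le_apply[of v "Gamma D v" s FF] by (simp add: admissible_def)
    ultimately show ?thesis using Gamma_FF_iff[of s D v] com by simp
  qed
  have mod: ?thesis if "v \<in> models D"
  proof -
    have "s \<in> args D" using that by (intro interps_mem[of v _ s, OF _ s]) (simp add: models_def)
    moreover from this have "tval v (ac D s) = FF" using that s by (auto simp: models_def)
    ultimately show ?thesis by (simp add: tval_def split: if_splits)
  qed
  have "v \<in> conflict_free D \<or> v \<in> admissible D \<or> v \<in> models D"
    using v complete_sub_admissible[of D]
    by (cases \<sigma>) (auto simp: stable_models_def grounded_eq preferred_def)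
  then show ?thesis using cf adm mod by blast
qed

lemma SETADF_rejections_explained:
  assumes "D \<in> SETADF" and "v \<in> sem \<sigma> D"
  shows "rejections_explained v"
  unfolding rejections_explained_def
proof (intro allI impI)
  fix s assume "v s = Some FF"
  then have "s \<in> args D" "\<not> eval (\<lambda>p. v p = Some TT) (ac D s)"
    using sem_rejected_condition[OF assms(2)] by auto
  moreover from this have "setadf_form (ac D s)" using assms(1) by (simp add: SETADF_def)
  \<comment> \<open>With nothing accepted the valuation would be all-false and satisfy the
    condition.\<close>
  ultimately show "\<exists>a. v a = Some TT"
    using setadf_form_eval_False[of "ac D s" "\<lambda>p. v p = Some TT"] by blast
qed

section \<open>Realizing the remaining sets of interpretations\<close>

lemma ex_SETADF:
  assumes "finite S" and ex: "\<And>s. s \<in> S \<Longrightarrow> \<exists>\<psi>. setadf_form \<psi> \<and> atoms \<psi> \<subseteq> S \<and> P s \<psi>"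
  shows "\<exists>E \<in> SETADF. args E = S \<and> (\<forall>s \<in> S. P s (ac E s))"
proof -
  obtain f where f: "\<And>s. s \<in> S \<Longrightarrow> setadf_form (f s) \<and> atoms (f s) \<subseteq> S \<and> P s (f s)"
    using ex by metis
  \<comment> \<open>Reading the links off the atoms makes this an ADF for any choice of formulas
    over \<open>S\<close>.\<close>
  let ?E = "\<lparr>args = S, links = {(b, a). a \<in> S \<and> b \<in> atoms (f a)}, ac = f\<rparr>"
  have "?E \<in> SETADF"
    using f assms(1) by (auto simp: SETADF_def is_adf_def par_def)
  then show ?thesis using f by (intro bexI[of _ ?E]) auto
qed

lemma SFADF_normal_form:
  assumes "D \<in> SFADF" and "s \<in> args D" and "satisfiable (ac D s)"
  shows "\<exists>\<psi>. setadf_form \<psi> \<and> atoms \<psi> \<subseteq> args D \<and> (\<forall>\<omega>. eval \<omega> \<psi> = eval \<omega> (ac D s))"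
proof -
  have "atoms (ac D s) \<subseteq> args D"
    using assms(1,2) by (auto simp: SFADF_def is_adf_def par_def)
  then show ?thesis
    using antitone_form_normal_form[OF antitone_form_ac[OF assms(1,2)] assms(3)]
    by (meson subset_trans)
qed

lemma finite_args_SFADF: "D \<in> SFADF \<Longrightarrow> finite (args D)"
  by (simp add: SFADF_def is_adf_def)

text \<open>The conditions of \<open>D\<close> and \<open>E\<close> differ only where that of
  \<open>D\<close> is unsatisfiable, and only under valuations false on all of
  \<open>args D\<close>. One true argument makes them agree.\<close>

locale unsatisfiable_replaced =
  fixes D E :: "'a adf"
  assumes finite_args: "finite (args D)"
    and args_E: "args E = args D"
    and eval_sat: "\<And>s \<omega>. s \<in> args D \<Longrightarrow> satisfiable (ac D s) \<Longrightarrow> eval \<omega> (ac E s) = eval \<omega> (ac D s)"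
    and eval_unsat: "\<And>s \<omega>. s \<in> args D \<Longrightarrow> \<not> satisfiable (ac D s) \<Longrightarrow>
      eval \<omega> (ac E s) \<longleftrightarrow> (\<forall>a \<in> args D. \<not> \<omega> a)"
begin

lemma eval_imp: "s \<in> args D \<Longrightarrow> eval \<omega> (ac D s) \<Longrightarrow> eval \<omega> (ac E s)"
  using eval_sat[of s \<omega>] by (auto simp: satisfiable_def)

lemma eval_eq: "s \<in> args D \<Longrightarrow> a \<in> args D \<Longrightarrow> \<omega> a \<Longrightarrow> eval \<omega> (ac E s) = eval \<omega> (ac D s)"
  using eval_sat[of s \<omega>] eval_unsat[of s \<omega>] by (auto simp: satisfiable_def)

text \<open>The true argument is \<open>s\<close> itself: the substitute condition makes
  \<open>s\<close> attack itself.\<close>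

lemma eval_eq_accepted:
  assumes "v s = Some TT" and "s \<in> args D" and "completion v \<omega>"
  shows "eval \<omega> (ac E s) = eval \<omega> (ac D s)"
  using assms eval_eq[of s s \<omega>] by (simp add: completion_def)

lemma eval_eq_rejected:
  assumes "rejections_explained v" and v: "v \<in> interps (args D)" and "v s = Some FF"
    and s: "s \<in> args D" and \<omega>: "completion v \<omega>"
  shows "eval \<omega> (ac E s) = eval \<omega> (ac D s)"
proof -
  obtain a where a: "v a = Some TT" using assms(1,3) by (auto simp: rejections_explained_def)
  then have "\<omega> a" using \<omega> by (simp add: completion_def)
  then show ?thesis using eval_eq[of s a \<omega>] s interps_mem[OF v a] by simp
qed

text \<open>Rejections pass from \<open>E\<close> to \<open>D\<close> because the conditions of
  \<open>D\<close> imply those of \<open>E\<close>; on accepted arguments the conditions agree. The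
  admissible case works alike.\<close>

lemma conflict_free_sub: "conflict_free E \<subseteq> conflict_free D"
proof
  fix v assume v: "v \<in> conflict_free E"
  have "\<not> eval \<omega> (ac D s)" if "s \<in> args D" "v s = Some FF" "completion v \<omega>" for s \<omega>
    using v that eval_imp[of s \<omega>] unfolding conflict_free_iff args_E by metis
  then show "v \<in> conflict_free D"
    using v unfolding conflict_free_iff args_E by (simp add: eval_eq_accepted cong: conj_cong)
qed

lemma conflict_free_sup:
  assumes v: "v \<in> conflict_free D" and expl: "rejections_explained v"
  shows "v \<in> conflict_free E"
proof -
  have "v \<in> interps (args D)" using v by (simp add: conflict_free_iff)
  then show ?thesis
    using v unfolding conflict_free_iff args_E
    by (simp add: eval_eq_accepted eval_eq_rejected[OF expl] cong: conj_cong)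
qed

lemma admissible_sub: "admissible E \<subseteq> admissible D"
proof
  fix v assume v: "v \<in> admissible E"
  have "\<not> eval \<omega> (ac D s)" if "s \<in> args D" "v s = Some FF" "completion v \<omega>" for s \<omega>
    using v that eval_imp[of s \<omega>] unfolding admissible_iff args_E by metis
  then show "v \<in> admissible D"
    using v unfolding admissible_iff args_E by (simp add: eval_eq_accepted cong: conj_cong)
qed

lemma admissible_sup:
  assumes v: "v \<in> admissible D" and expl: "rejections_explained v"
  shows "v \<in> admissible E"
proof -
  have "v \<in> interps (args D)" using v by (simp add: admissible_iff)
  then show ?thesis
    using v unfolding admissible_iff args_E
    by (simp add: eval_eq_accepted eval_eq_rejected[OF expl])
qed

lemma models_sub: "models E \<subseteq> models D"
proof
  fix v assume v: "v \<in> models E"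
  let ?\<omega> = "\<lambda>p. v p = Some TT"
  have "eval ?\<omega> (ac D s) = eval ?\<omega> (ac E s)" if s: "s \<in> args D" for s
  proof (cases "v s = Some TT")
    case True
    then show ?thesis using eval_eq[OF s s, of ?\<omega>] by simp
  next
    case False
    then show ?thesis using v s eval_imp[OF s, of ?\<omega>] by (auto simp: models_iff args_E)
  qed
  then show "v \<in> models D" using v by (simp add: models_iff args_E)
qed

lemma models_sup:
  assumes v: "v \<in> models D" and expl: "rejections_explained v"
  shows "v \<in> models E"
proof -
  let ?\<omega> = "\<lambda>p. v p = Some TT"
  have vi: "v \<in> interps (args D)" and "two_valued v" using v by (simp_all add: models_iff)
  have com: "completion v ?\<omega>" by (simp add: completion_def)
  have "eval ?\<omega> (ac E s) = eval ?\<omega> (ac D s)" if s: "s \<in> args D" for s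
  proof -
    obtain x where x: "v s = Some x" using interps_Some[OF vi s] by blast
    then have "x \<noteq> UU" using \<open>two_valued v\<close> domI[of v s x] by (auto simp: two_valued_def)
    then show ?thesis
      using x eval_eq_accepted[OF _ s com] eval_eq_rejected[OF expl vi _ s com] by (cases x) simp_all
  qed
  then show ?thesis using v by (simp add: models_iff args_E)
qed

text \<open>The reduct keeps only arguments accepted by the model \<open>v\<close>. Their conditions
  hold under \<open>v\<close>, so they are satisfiable and were not replaced.\<close>

lemma grounded_reduct:
  assumes "v \<in> models D"
  shows "grounded (reduct E v) = grounded (reduct D v)"
proof -
  have "eval \<omega> (ac (reduct E v) s) = eval \<omega> (ac (reduct D v) s)" if "s \<in> trues v" for s \<omega>
  proof -
    have s: "v s = Some TT" "v \<in> interps (args D)"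
      using assms that by (simp_all add: models_iff trues_def)
    then have "s \<in> args D" using interps_mem by metis
    moreover from this have "satisfiable (ac D s)"
      using assms s by (auto simp: models_iff satisfiable_def)
    ultimately show ?thesis by (simp add: reduct_def eval_subst eval_sat)
  qed
  then have "Gamma (reduct E v) w = Gamma (reduct D v) w" for w
    by (intro ext Gamma_cong) (simp_all add: args_reduct)
  then show ?thesis by (simp add: grounded_def args_reduct)
qed

lemma stable_models_sub: "stable_models E \<subseteq> stable_models D"
  using models_sub grounded_reduct by (auto simp: stable_models_def)

lemma stable_models_sup:
  assumes "v \<in> stable_models D" and "rejections_explained v"
  shows "v \<in> stable_models E"
  using assms models_sup grounded_reduct by (auto simp: stable_models_def)

text \<open>An interpretation preferred in \<open>E\<close> extends to one preferred in
  \<open>D\<close>; the latter is explained, hence admissible in \<open>E\<close>, so maximality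
  identifies the two.\<close>

lemma preferred_sub:
  assumes "\<And>v. v \<in> preferred D \<Longrightarrow> rejections_explained v"
  shows "preferred E \<subseteq> preferred D"
proof
  fix w assume w: "w \<in> preferred E"
  then have "w \<in> admissible D" using admissible_sub by (auto simp: preferred_def)
  then obtain v where v: "v \<in> preferred D" "w \<le>\<^sub>i v"
    using ex_preferred_above finite_args by blast
  then have "v \<in> admissible E" using assms admissible_sup by (auto simp: preferred_def)
  then show "w \<in> preferred D" using v w by (auto simp: preferred_def)
qed

lemma preferred_sup:
  assumes "v \<in> preferred D" and "rejections_explained v"
  shows "v \<in> preferred E"
  using assms admissible_sub admissible_sup by (auto simp: preferred_def)

text \<open>The exclusions are genuine: if \<open>a\<close> has condition \<open>Bot\<close> and
  \<open>b\<close> has \<open>Neg (Atom a)\<close>, then \<open>D\<close> has one complete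
  interpretation, rejecting \<open>a\<close> and accepting \<open>b\<close>, while in
  \<open>E\<close> leaving both undecided is complete too.\<close>

lemma sem_eq:
  assumes "\<sigma> \<notin> {COM, GRD}" and "\<And>v. v \<in> sem \<sigma> D \<Longrightarrow> rejections_explained v"
  shows "sem \<sigma> E = sem \<sigma> D"
proof (rule equalityI)
  show "sem \<sigma> E \<subseteq> sem \<sigma> D"
    using assms conflict_free_sub admissible_sub models_sub stable_models_sub preferred_sub
    by (cases \<sigma>) auto
  show "sem \<sigma> D \<subseteq> sem \<sigma> E"
    using assms conflict_free_sup admissible_sup models_sup stable_models_sup preferred_sup
    by (cases \<sigma>) auto
qed

end

lemma ex_SETADF_same_sem:
  assumes D: "D \<in> SFADF" and "\<sigma> \<notin> {COM, GRD}"
    and "\<And>v. v \<in> sem \<sigma> D \<Longrightarrow> rejections_explained v"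
  shows "\<exists>E \<in> SETADF. sem \<sigma> E = sem \<sigma> D"
proof -
  let ?P = "\<lambda>s \<psi>. \<forall>\<omega>. if satisfiable (ac D s) then eval \<omega> \<psi> = eval \<omega> (ac D s)
    else eval \<omega> \<psi> \<longleftrightarrow> (\<forall>a \<in> args D. \<not> \<omega> a)"
  have "\<exists>\<psi>. setadf_form \<psi> \<and> atoms \<psi> \<subseteq> args D \<and> ?P s \<psi>" if "s \<in> args D" for s
    using SFADF_normal_form[OF D that] ex_setadf_form_none[OF finite_args_SFADF[OF D]]
    by (cases "satisfiable (ac D s)") simp_all
  then obtain E where E: "E \<in> SETADF" "args E = args D" "\<And>s. s \<in> args D \<Longrightarrow> ?P s (ac E s)"
    using ex_SETADF[of "args D" ?P] finite_args_SFADF[OF D] by blast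
  interpret unsatisfiable_replaced D E
    using E finite_args_SFADF[OF D] by unfold_locales (auto split: if_splits)
  show ?thesis using E(1) sem_eq assms by blast
qed

text \<open>Above \<open>g\<close> the operators of \<open>D\<close> and \<open>E\<close> coincide,
  and the complete interpretations of both lie above \<open>g\<close>. So both operators have the
  same fixed points.\<close>

lemma complete_eq_if_grounded_forced:
  assumes g: "g \<in> grounded D" and args: "args E = args D"
    and TT: "\<And>s \<omega>. s \<in> args D \<Longrightarrow> g s = Some TT \<Longrightarrow> eval \<omega> (ac E s)"
    and FF: "\<And>s \<omega>. s \<in> args D \<Longrightarrow> g s = Some FF \<Longrightarrow> eval \<omega> (ac E s) \<longleftrightarrow> (\<forall>a \<in> args D. \<not> \<omega> a)"
    and UU: "\<And>s \<omega>. s \<in> args D \<Longrightarrow> g s = Some UU \<Longrightarrow> eval \<omega> (ac E s) = eval \<omega> (ac D s)"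
    and expl: "rejections_explained g"
  shows "complete E = complete D"
proof -
  have gi: "g \<in> interps (args D)" and gG: "Gamma D g = g"
    using g by (auto simp: grounded_def)
  \<comment> \<open>By monotonicity \<open>Gamma D\<close> keeps the decisions of \<open>g\<close>
    above \<open>g\<close>; the conditions of \<open>E\<close> impose the same ones, rejections
    being triggered by an accepted argument.\<close>
  have forced: "Gamma E v = Gamma D v" if v: "v \<in> interps (args D)" and le: "g \<le>\<^sub>i v" for v
  proof
    fix s
    have GD: "Gamma D v s = g s" if "g s = Some x" "x \<noteq> UU" for x
      using info_le_apply[OF Gamma_mono[OF le, of D]] that gG by simp
    consider "s \<notin> args D" | "s \<in> args D" "g s = Some TT" | "s \<in> args D" "g s = Some FF"
      | "s \<in> args D" "g s = Some UU"
      using interps_Some[OF gi, of s] by (metis tv.exhaust)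
    then show "Gamma E v s = Gamma D v s"
    proof cases
      case 1
      then show ?thesis by (simp add: Gamma_def args)
    next
      case 2
      then show ?thesis using GD TT Gamma_TT_iff[of s E v] args by simp
    next
      case 3
      obtain a where a: "g a = Some TT" using 3(2) expl unfolding rejections_explained_def by blast
      then have "a \<in> args D" "v a = Some TT"
        using interps_mem[OF gi a] info_le_apply[OF le a] by simp_all
      then have "Gamma E v s = Some FF"
        using 3 FF Gamma_FF_iff[of s E v] args by (auto simp: completion_def)
      then show ?thesis using GD 3 by simp
    next
      case 4
      then show ?thesis using UU by (intro Gamma_cong) (simp_all add: args)
    qed
  qed
  have leE: "g \<le>\<^sub>i v" if v: "v \<in> complete E" for v
  proof -
    have vi: "v \<in> interps (args D)" and vG: "Gamma E v = v"
      using v args by (auto simp: complete_def)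
    \<comment> \<open>Acceptances come first, since one of them makes the conditions of the
      arguments rejected by \<open>g\<close> fail.\<close>
    have t: "v s = Some TT" if "g s = Some TT" for s
    proof -
      have "s \<in> args D" using interps_mem[OF gi that] .
      then show ?thesis using Gamma_TT_iff[of s E v] TT that vG args by simp
    qed
    have "v s = Some FF" if s: "s \<in> args D" "g s = Some FF" for s
    proof -
      obtain a where a: "g a = Some TT" using s(2) expl unfolding rejections_explained_def by blast
      then have "a \<in> args D" "v a = Some TT" using interps_mem[OF gi a] t by simp_all
      then show ?thesis
        using s FF Gamma_FF_iff[of s E v] args vG by (auto simp: completion_def)
    qed
    then show ?thesis using t by (simp add: info_le_iff[OF gi vi])
  qed
  have leD: "g \<le>\<^sub>i v" if "v \<in> complete D" for v
    using g that by (auto simp: grounded_eq)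
  show ?thesis
  proof (intro set_eqI iffI)
    fix v assume v: "v \<in> complete E"
    then have vi: "v \<in> interps (args D)" and vG: "v = Gamma E v"
      using args by (simp_all add: complete_def)
    have "v = Gamma D v" using vG forced[OF vi leE[OF v]] by (rule trans)
    then show "v \<in> complete D" using vi by (simp add: complete_def)
  next
    fix v assume v: "v \<in> complete D"
    then have vi: "v \<in> interps (args D)" and vG: "v = Gamma D v"
      by (simp_all add: complete_def)
    have "v = Gamma E v" using vG forced[OF vi leD[OF v], symmetric] by (rule trans)
    then show "v \<in> complete E" using vi args by (simp add: complete_def)
  qed
qed

lemma ex_SETADF_same_complete:
  assumes D: "D \<in> SFADF" and g: "g \<in> grounded D" and expl: "rejections_explained g"
  shows "\<exists>E \<in> SETADF. complete E = complete D"
proof -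
  let ?P = "\<lambda>s \<psi>. \<forall>\<omega>. if g s = Some TT then eval \<omega> \<psi>
    else if g s = Some FF then eval \<omega> \<psi> \<longleftrightarrow> (\<forall>a \<in> args D. \<not> \<omega> a)
    else eval \<omega> \<psi> = eval \<omega> (ac D s)"
  have "\<exists>\<psi>. setadf_form \<psi> \<and> atoms \<psi> \<subseteq> args D \<and> ?P s \<psi>" if s: "s \<in> args D" for s
  proof -
    \<comment> \<open>The fixed point \<open>g\<close> rejects every argument with an unsatisfiable
      condition, so undecided arguments have a clausal form.\<close>
    have "satisfiable (ac D s)" if "g s \<noteq> Some FF"
      using that g Gamma_FF_iff[OF s, of g] by (auto simp: grounded_def satisfiable_def)
    then consider "g s = Some TT" | "g s = Some FF"
      | "g s \<noteq> Some TT" "g s \<noteq> Some FF" "satisfiable (ac D s)"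
      by blast
    then show ?thesis
    proof cases
      case 1
      then show ?thesis using ex_setadf_form_none[of "{}"] by auto
    next
      case 2
      then show ?thesis using ex_setadf_form_none[OF finite_args_SFADF[OF D]] by simp
    next
      case 3
      then show ?thesis using SFADF_normal_form[OF D s] by simp
    qed
  qed
  then obtain E where E: "E \<in> SETADF" "args E = args D" "\<And>s. s \<in> args D \<Longrightarrow> ?P s (ac E s)"
    using ex_SETADF[of "args D" ?P] finite_args_SFADF[OF D] by blast
  have "complete E = complete D"
    using E(3) by (intro complete_eq_if_grounded_forced[OF g E(2) _ _ _ expl]) auto
  then show ?thesis using E(1) by blast
qed

theorem theorem11:
  fixes \<sigma> :: semantics
  shows "(Delta \<sigma> :: 'a interp set set) = signature SFADF \<sigma> - signature SETADF \<sigma>"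
proof -
  have realize: "\<exists>E \<in> SETADF. sem \<sigma> E = sem \<sigma> D"
    if D: "D \<in> SFADF" and expl: "\<And>v. v \<in> sem \<sigma> D \<Longrightarrow> rejections_explained v"
    for D :: "'a adf"
  proof (cases "\<sigma> \<in> {COM, GRD}")
    case True
    obtain g where g: "g \<in> grounded D" using grounded_exists finite_args_SFADF D by blast
    \<comment> \<open>The grounded interpretation is itself complete, so it belongs to
      \<open>sem \<sigma> D\<close> in both cases.\<close>
    then have "rejections_explained g" using True expl by (auto simp: grounded_eq)
    then obtain E where E: "E \<in> SETADF" "complete E = complete D"
      using ex_SETADF_same_complete D g by blast
    then have "sem \<sigma> E = sem \<sigma> D" using True by (auto simp: grounded_eq)
    then show ?thesis using E(1) by blast
  next
    case False
    then show ?thesis using ex_SETADF_same_sem D expl by blast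
  qed
  show ?thesis
  proof (intro equalityI subsetI DiffI)
    fix V :: "'a interp set" assume V: "V \<in> Delta \<sigma>"
    then show "V \<in> signature SFADF \<sigma>" by (simp add: Delta_eq)
    obtain v where "v \<in> V" "\<not> rejections_explained v" using V by (auto simp: Delta_eq)
    then show "V \<notin> signature SETADF \<sigma>"
      using SETADF_rejections_explained[of _ v \<sigma>] by (auto simp: signature_def)
  next
    fix V :: "'a interp set" assume V: "V \<in> signature SFADF \<sigma> - signature SETADF \<sigma>"
    then obtain D where D: "D \<in> SFADF" "V = sem \<sigma> D" by (auto simp: signature_def)
    have "\<exists>v \<in> V. \<not> rejections_explained v"
    proof (rule ccontr)
      assume "\<not> (\<exists>v \<in> V. \<not> rejections_explained v)"
      then obtain E where "E \<in> SETADF" "sem \<sigma> E = V" using realize[OF D(1)] D(2) by blast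
      then show False using V by (auto simp: signature_def)
    qed
    then show "V \<in> Delta \<sigma>" using V by (simp add: Delta_eq)
  qed
qed

end
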